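(* Let $n\ge 2$, let $\Omega\subset\mathbb{R}^n$ be a domain, let $0<\delta\le 1$, and let $f\colon\Omega\to\mathbb{R}^n$ be nonconstant and $\delta$-monotone. Let $x_0\in\Omega$ with $f(x_0)\neq 0$. Then the initial value problem $$\dot{x}(t)=f(x(t)),\qquad x(0)=x_0$$ admits a unique local solution: there is a solution defined on some open interval containing $0$, and any two solutions defined on open intervals containing $0$ coincide on some neighbourhood of $0$.
   Context: A map $f\colon\Omega\to\mathbb{R}^n$ (not assumed continuous a priori) is called $\delta$-monotone, $0<\delta\le 1$, if $$\langle f(a)-f(b),\,a-b\rangle\ \ge\ \delta\,|a-b|\,|f(a)-f(b)|\qquad\text{for all } a,b\in\Omega,$$ where $\langle\cdot,\cdot\rangle$ and $|\cdot|$ are the Euclidean inner product and norm. A solution on an open interval $I$ is a differentiable function $x\colon I\to\Omega$ satisfying the equation at every point of $I$. *)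

theory Defs
  imports "HOL-Analysis.Analysis"
begin

definition delta_monotone_on :: "real \<Rightarrow> 'a::real_inner set \<Rightarrow> ('a \<Rightarrow> 'a) \<Rightarrow> bool" where
  "delta_monotone_on \<delta> \<Omega> f \<longleftrightarrow>
     (\<forall>a\<in>\<Omega>. \<forall>b\<in>\<Omega>. (f a - f b) \<bullet> (a - b) \<ge> \<delta> * norm (a - b) * norm (f a - f b))"

text \<open>Intervals may be unbounded. A solution is a total function of which only the values on the
  open interval \<open>I\<close> matter: \<open>I\<close> is open, so the derivative at a point of \<open>I\<close> depends on nothing else.\<close>

definition autonomous_solution ::
    "('a::real_normed_vector \<Rightarrow> 'a) \<Rightarrow> 'a set \<Rightarrow> real set \<Rightarrow> (real \<Rightarrow> 'a) \<Rightarrow> bool" where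
  "autonomous_solution f \<Omega> I x \<longleftrightarrow>
     open I \<and> is_interval I \<and>
     (\<forall>t\<in>I. x t \<in> \<Omega> \<and> (x has_vector_derivative f (x t)) (at t))"

definition autonomous_ivp_solution ::
    "('a::real_normed_vector \<Rightarrow> 'a) \<Rightarrow> 'a set \<Rightarrow> 'a \<Rightarrow> real set \<Rightarrow> (real \<Rightarrow> 'a) \<Rightarrow> bool" where
  "autonomous_ivp_solution f \<Omega> x0 I x \<longleftrightarrow>
     autonomous_solution f \<Omega> I x \<and> 0 \<in> I \<and> x 0 = x0"

end

theory Submission
  imports Defs "HOL-Complex_Analysis.Great_Picard"
begin

text \<open>
  Three points that are almost collinear force a \<open>\<delta>\<close>-monotone map to satisfy
  \<open>|f(x+b) - f(x)| \<le> C |f(x+c) - f(x)|\<close> for \<open>c\<close> near \<open>2b\<close>. In dimension at least two every direction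
  can be rotated into every other one, so chaining such steps shows that \<open>f\<close> is weakly quasisymmetric;
  continuity follows because \<open>f\<close> is monotone along a segment, and Peano's theorem gives existence.

  Two solutions \<open>x, y\<close> with the same initial value spread monotonically, which is uniqueness backwards
  in time. Forwards, let \<open>\<omega> = |x - y|\<close>, \<open>v = f(x0)\<close> and \<open>\<phi>(t) = \<langle>f(x(t)), v\<rangle>\<close>. Since \<open>x\<close> moves roughly in
  direction \<open>v\<close>, \<open>\<phi>\<close> is nondecreasing and controls the variation of \<open>f\<close> along \<open>x\<close>; quasisymmetry compares
  the sideways difference \<open>f(x) - f(y)\<close> with a difference along \<open>x\<close>, whence
  \<open>\<omega>'(t) \<le> A (\<phi>(t + L \<omega>(t)) - \<phi>(t))\<close>. As \<open>t + L \<omega>(t)\<close> has speed at least one, integration gives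
  \<open>\<omega>(T) \<le> A \<integral> (\<phi> - \<phi>(0))\<close> over \<open>[T, T + L \<omega>(T)]\<close>, which is at most \<open>\<omega>(T) / 4\<close> for small \<open>T\<close>, so
  \<open>\<omega>(T) = 0\<close>.
\<close>

section \<open>Weak quasisymmetry and continuity\<close>

lemma delta_monotone_onD:
  assumes "delta_monotone_on \<delta> \<Omega> f" "a \<in> \<Omega>" "b \<in> \<Omega>"
  shows "\<delta> * norm (a - b) * norm (f a - f b) \<le> (f a - f b) \<bullet> (a - b)"
  using assms unfolding delta_monotone_on_def by blast

lemma delta_monotone_on_imp_inner_nonneg:
  assumes "delta_monotone_on \<delta> \<Omega> f" "0 \<le> \<delta>" "a \<in> \<Omega>" "b \<in> \<Omega>"
  shows "0 \<le> (f a - f b) \<bullet> (a - b)"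
  using delta_monotone_onD[OF assms(1,3,4)] assms(2)
  by (meson mult_nonneg_nonneg norm_ge_zero order_trans)

text \<open>With \<open>B\<close> and \<open>C\<close> the increments of \<open>f\<close> along
  \<open>b\<close> and \<open>c\<close>, monotonicity gives B.(c-b) \<le> C.(c-b). Since c-b differs
  from b by at most (\<delta>/2)|b|, half of the lower bound \<delta>|b||B| for B.b survives, and
  Cauchy-Schwarz bounds the right side by 2|b||C|.\<close>

lemma delta_monotone_on_doubling:
  assumes f: "delta_monotone_on \<delta> \<Omega> f" and \<delta>: "0 < \<delta>" "\<delta> \<le> 1"
    and \<Omega>: "x \<in> \<Omega>" "x + b \<in> \<Omega>" "x + c \<in> \<Omega>"
    and c: "norm (c - 2 *\<^sub>R b) \<le> \<delta> / 2 * norm b"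
  shows "norm (f (x + b) - f x) \<le> 4 / \<delta> * norm (f (x + c) - f x)"
proof (cases "b = 0")
  case False
  define B C where "B = f (x + b) - f x" and "C = f (x + c) - f x"
  have 1: "\<delta> * norm b * norm B \<le> B \<bullet> b"
    using delta_monotone_onD[OF f \<Omega>(2,1)] by (simp add: B_def)
  have 2: "0 \<le> (C - B) \<bullet> (c - b)"
    using delta_monotone_on_imp_inner_nonneg[OF f _ \<Omega>(3,2)] \<delta> by (simp add: B_def C_def)
  have 3: "- (B \<bullet> (c - 2 *\<^sub>R b)) \<le> norm B * (\<delta> / 2 * norm b)"
    using Cauchy_Schwarz_ineq2[of B "c - 2 *\<^sub>R b"] mult_left_mono[OF c, of "norm B"] by simp
  have "norm (c - b) \<le> norm (c - 2 *\<^sub>R b) + norm b"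
    using norm_triangle_ineq[of "c - 2 *\<^sub>R b" b] by (simp add: scaleR_2)
  also have "\<dots> \<le> \<delta> / 2 * norm b + norm b" using c by simp
  also have "\<dots> \<le> 2 * norm b"
    using mult_right_mono[of "\<delta> / 2" 1 "norm b"] \<delta> by simp
  finally have 4: "C \<bullet> (c - b) \<le> norm C * (2 * norm b)"
    by (meson mult_left_mono norm_cauchy_schwarz norm_ge_zero order_trans)
  have "C \<bullet> (c - b) = (C - B) \<bullet> (c - b) + B \<bullet> b + B \<bullet> (c - 2 *\<^sub>R b)"
    by (simp add: inner_diff_left inner_diff_right)
  with 1 2 3 4 have "\<delta> / 2 * norm B * norm b \<le> 2 * norm C * norm b"
    by (simp add: algebra_simps)
  with False have "\<delta> / 2 * norm B \<le> 2 * norm C"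
    by simp
  with \<delta> show ?thesis by (simp add: B_def C_def field_simps)
qed (use \<delta> in simp)

section \<open>Turning directions by repeated doubling\<close>

text \<open>\<open>q j\<close> is the direction at stage \<open>j\<close> with the factor 2^j
  divided out. Scaled back, a relative change \<delta>/4 of \<open>q\<close> is exactly the error
  \<delta>/2 allowed in one doubling.\<close>

lemma delta_monotone_on_chain:
  assumes f: "delta_monotone_on \<delta> \<Omega> f" and \<delta>: "0 < \<delta>" "\<delta> \<le> 1" and x: "x \<in> \<Omega>"
    and \<Omega>: "\<And>j. j \<le> N \<Longrightarrow> x + 2 ^ j *\<^sub>R q j \<in> \<Omega>"
    and q: "\<And>j. j < N \<Longrightarrow> norm (q (Suc j) - q j) \<le> \<delta> / 4 * norm (q j)"
  shows "norm (f (x + q 0) - f x) \<le> (4 / \<delta>) ^ N * norm (f (x + 2 ^ N *\<^sub>R q N) - f x)"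
  using \<Omega> q
proof (induction N)
  case (Suc N)
  have "norm (2 ^ Suc N *\<^sub>R q (Suc N) - 2 *\<^sub>R 2 ^ N *\<^sub>R q N) =
      2 ^ Suc N * norm (q (Suc N) - q N)"
    by (simp flip: scaleR_diff_right)
  also have "\<dots> \<le> 2 ^ Suc N * (\<delta> / 4 * norm (q N))"
    using Suc.prems(2)[of N] by (intro mult_left_mono) auto
  finally have "norm (2 ^ Suc N *\<^sub>R q (Suc N) - 2 *\<^sub>R 2 ^ N *\<^sub>R q N) \<le>
      \<delta> / 2 * norm (2 ^ N *\<^sub>R q N)" by (simp add: mult.commute)
  then have "norm (f (x + 2 ^ N *\<^sub>R q N) - f x) \<le>
      4 / \<delta> * norm (f (x + 2 ^ Suc N *\<^sub>R q (Suc N)) - f x)"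
    using Suc.prems(1)[of N] Suc.prems(1)[of "Suc N"]
    by (intro delta_monotone_on_doubling[OF f \<delta> x]) auto
  then have "(4 / \<delta>) ^ N * norm (f (x + 2 ^ N *\<^sub>R q N) - f x) \<le>
      (4 / \<delta>) ^ N * (4 / \<delta> * norm (f (x + 2 ^ Suc N *\<^sub>R q (Suc N)) - f x))"
    using \<delta> by (intro mult_left_mono) auto
  moreover have "norm (f (x + q 0) - f x) \<le> (4 / \<delta>) ^ N * norm (f (x + 2 ^ N *\<^sub>R q N) - f x)"
    using Suc by simp
  ultimately show ?case by (simp add: ac_simps)
qed simp

text \<open>The turn follows the chord from \<open>h\<close> to \<open>k\<close> in \<open>N\<close>
  equal steps. As the angle is at most a right angle, the chord keeps distance at least r/2 from 0,
  so steps of length at most 2r/N \<le> \<delta>r/8 meet the tolerance of the chain; this fixes the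
  size of \<open>N\<close>.\<close>

lemma delta_monotone_on_quarter_turn:
  assumes f: "delta_monotone_on \<delta> \<Omega> f" and \<delta>: "0 < \<delta>" "\<delta> \<le> 1"
    and N: "16 / \<delta> \<le> real N"
    and hk: "norm h = r" "norm k = r" "0 \<le> h \<bullet> k" and \<Omega>: "cball x (2 ^ N * r) \<subseteq> \<Omega>"
  shows "norm (f (x + h) - f x) \<le> (4 / \<delta>) ^ N * norm (f (x + 2 ^ N *\<^sub>R k) - f x)"
proof -
  define q where "q j = (1 - real j / real N) *\<^sub>R h + (real j / real N) *\<^sub>R k" for j
  have r: "r \<ge> 0" using hk by auto
  have Npos: "real N > 0" using N \<delta> by (smt (verit) divide_pos_pos)
  have q_le: "norm (q j) \<le> r" if "j \<le> N" for j
    using that Npos hk convexD_alt[OF convex_cball, of h 0 r k "real j / real N"]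
    by (simp add: q_def)
  have q_ge: "r / 2 \<le> norm (q j)" if "j \<le> N" for j
  proof -
    define s where "s = real j / real N"
    have s: "0 \<le> s" "s \<le> 1" using that Npos by (auto simp: s_def)
    have "(norm (q j))\<^sup>2 = (1 - s)\<^sup>2 * (h \<bullet> h) + s\<^sup>2 * (k \<bullet> k) + 2 * s * (1 - s) * (h \<bullet> k)"
      unfolding q_def s_def[symmetric] power2_norm_eq_inner
      by (simp add: inner_add_left inner_add_right power2_eq_square inner_commute algebra_simps)
    also have "\<dots> \<ge> (1 - s)\<^sup>2 * r\<^sup>2 + s\<^sup>2 * r\<^sup>2"
      using s hk by (simp flip: power2_norm_eq_inner)
    finally have "(norm (q j))\<^sup>2 \<ge> ((1 - s)\<^sup>2 + s\<^sup>2) * r\<^sup>2" by (simp add: algebra_simps)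
    moreover have "(1 - s)\<^sup>2 + s\<^sup>2 \<ge> 1 / 4"
      using zero_le_power2[of "2 * s - 1"] by (simp add: power2_eq_square algebra_simps)
    then have "((1 - s)\<^sup>2 + s\<^sup>2) * r\<^sup>2 \<ge> 1 / 4 * r\<^sup>2" by (intro mult_right_mono) auto
    ultimately have "(r / 2)\<^sup>2 \<le> (norm (q j))\<^sup>2" by (simp add: power_divide)
    then show ?thesis by (rule power2_le_imp_le) simp
  qed
  have "norm (q (Suc j) - q j) \<le> \<delta> / 4 * norm (q j)" if "j < N" for j
  proof -
    have "q (Suc j) - q j = (1 / real N) *\<^sub>R (k - h)"
      by (simp add: q_def add_divide_distrib algebra_simps)
    then have "norm (q (Suc j) - q j) = norm (k - h) / real N" by simp
    also have "\<dots> \<le> (2 * r) / (16 / \<delta>)"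
      using norm_triangle_ineq4[of k h] hk N \<delta> r by (intro frac_le) auto
    also have "\<dots> = \<delta> / 4 * (r / 2)" by simp
    also have "\<dots> \<le> \<delta> / 4 * norm (q j)" using q_ge[of j] that \<delta> by (intro mult_left_mono) auto
    finally show ?thesis .
  qed
  moreover have "x + 2 ^ j *\<^sub>R q j \<in> \<Omega>" if "j \<le> N" for j
    using that q_le[of j] r \<Omega> mult_mono[of "2 ^ j" "2 ^ N" "norm (q j)" r]
    by (auto simp: dist_norm subset_iff)
  moreover have "x \<in> \<Omega>" using \<Omega> r by auto
  ultimately have "norm (f (x + q 0) - f x) \<le> (4 / \<delta>) ^ N * norm (f (x + 2 ^ N *\<^sub>R q N) - f x)"
    by (intro delta_monotone_on_chain[OF f \<delta>]) auto
  then show ?thesis using Npos by (simp add: q_def)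
qed

text \<open>Splits an arbitrary rotation into two quarter turns. The bisector \<open>h + k\<close>
  works unless it vanishes; opposite vectors have a common orthogonal vector, and here dimension at
  least two enters.\<close>

lemma exists_vector_inner_nonneg_both:
  fixes h k :: "'a::euclidean_space"
  assumes "DIM('a) \<ge> 2" "norm h = norm k"
  obtains z where "norm z = norm h" "0 \<le> h \<bullet> z" "0 \<le> z \<bullet> k"
proof -
  obtain y where y: "y \<noteq> 0" "h \<bullet> y \<ge> 0" "y \<bullet> k \<ge> 0"
  proof (cases "h + k = 0")
    case True
    then have "k = - h" by (simp add: add_eq_0_iff)
    with that orthogonal_to_vector_exists[OF assms(1), of h] show ?thesis
      by (auto simp: orthogonal_def inner_commute)
  next
    case False
    have "\<bar>h \<bullet> k\<bar> \<le> (norm h)\<^sup>2"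
      using Cauchy_Schwarz_ineq2[of h k] assms(2) by (simp add: power2_eq_square)
    then have "h \<bullet> (h + k) \<ge> 0 \<and> (h + k) \<bullet> k \<ge> 0"
      using assms(2) by (auto simp: inner_add_left inner_add_right simp flip: power2_norm_eq_inner)
    with that False show ?thesis by blast
  qed
  show ?thesis
    by (rule that[of "(norm h / norm y) *\<^sub>R y"]) (use y in auto)
qed

text \<open>For exactly collinear points the constant is independent of \<open>l\<close>:
  monotonicity gives B.b \<le> C.b, where \<delta>|b||B| \<le> B.b and C.b \<le> |b||C|. The case l
  = 1 is separate because the argument divides by l-1.\<close>

lemma delta_monotone_on_ray:
  assumes f: "delta_monotone_on \<delta> \<Omega> f" and \<delta>: "0 < \<delta>"
    and \<Omega>: "x \<in> \<Omega>" "x + b \<in> \<Omega>" "x + l *\<^sub>R b \<in> \<Omega>" and l: "1 \<le> l"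
  shows "norm (f (x + b) - f x) \<le> 1 / \<delta> * norm (f (x + l *\<^sub>R b) - f x)"
proof (cases "l = 1 \<or> b = 0")
  case True
  then show ?thesis
  proof
    assume "l = 1"
    have "\<delta> * norm b * norm (f (x + b) - f x) \<le> norm (f (x + b) - f x) * norm b"
      using delta_monotone_onD[OF f \<Omega>(2,1)] norm_cauchy_schwarz[of "f (x + b) - f x" b]
      by simp
    then have "b \<noteq> 0 \<Longrightarrow> \<delta> * norm (f (x + b) - f x) \<le> norm (f (x + b) - f x)"
      by (simp add: mult.assoc mult.left_commute mult.commute[of "norm (f (x + b) - f x)"])
    with \<open>l = 1\<close> \<delta> show ?thesis
      by (cases "b = 0") (auto simp: field_simps)
  qed (use \<delta> in simp)
next
  case False
  with l have l1: "l > 1" and b: "b \<noteq> 0" by auto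
  define B C where "B = f (x + b) - f x" and "C = f (x + l *\<^sub>R b) - f x"
  have 1: "\<delta> * norm b * norm B \<le> B \<bullet> b"
    using delta_monotone_onD[OF f \<Omega>(2,1)] by (simp add: B_def)
  have "0 \<le> (C - B) \<bullet> ((l - 1) *\<^sub>R b)"
    using delta_monotone_on_imp_inner_nonneg[OF f _ \<Omega>(3,2)] \<delta>
    by (simp add: B_def C_def algebra_simps)
  with l1 have "0 \<le> (C - B) \<bullet> b" by (simp add: zero_le_mult_iff)
  then have "B \<bullet> b \<le> C \<bullet> b" by (simp add: inner_diff_left)
  also have "\<dots> \<le> norm C * norm b" by (rule norm_cauchy_schwarz)
  finally have "\<delta> * norm B * norm b \<le> norm C * norm b" using 1 by (simp add: ac_simps)
  with b have "\<delta> * norm B \<le> norm C" by simp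
  with \<delta> show ?thesis by (simp add: B_def C_def field_simps)
qed

lemma delta_monotone_on_weakly_quasisymmetric:
  fixes f :: "'a::euclidean_space \<Rightarrow> 'a"
  assumes dim: "DIM('a) \<ge> 2"
    and f: "delta_monotone_on \<delta> \<Omega> f" and \<delta>: "0 < \<delta>" "\<delta> \<le> 1"
  obtains M K where "M \<ge> 1" "K \<ge> 1"
    "\<And>x h k. M * norm h \<le> norm k \<Longrightarrow> cball x (norm k) \<subseteq> \<Omega> \<Longrightarrow>
      norm (f (x + h) - f x) \<le> K * norm (f (x + k) - f x)"
proof -
  obtain N where N: "16 / \<delta> \<le> real N" using real_arch_simple by blast
  \<comment> \<open>Each of two quarter turns lengthens the vector by 2^N and costs (4/\<delta>)^N;
    the factor 1/\<delta> pays for stretching along the ray to \<open>k\<close>.\<close>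
  define M K where "M = (2 ^ N * 2 ^ N :: real)" and "K = (4 / \<delta>) ^ N * (4 / \<delta>) ^ N * (1 / \<delta>)"
  have M: "M \<ge> 1" unfolding M_def using one_le_power[of 2 N] by (simp flip: power_mult_distrib)
  have "4 / \<delta> \<ge> 1" "1 / \<delta> \<ge> 1" using \<delta> by auto
  then have K: "K \<ge> 1" unfolding K_def
    by (intro mult_ge1_I one_le_power)
  have "norm (f (x + h) - f x) \<le> K * norm (f (x + k) - f x)"
    if hk: "M * norm h \<le> norm k" and \<Omega>: "cball x (norm k) \<subseteq> \<Omega>" for x h k
  proof (cases "h = 0")
    case False
    define r where "r = norm h"
    have r: "r > 0" using False by (simp add: r_def)
    then have k: "norm k > 0" using hk M by (smt (verit) mult_pos_pos r_def)
    \<comment> \<open>\<open>k'\<close> points along \<open>k\<close> with the length of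
      \<open>h\<close>. The route is h, 2^N z, 4^N k', k, all within the ball of radius |k| about
      \<open>x\<close>.\<close>
    define k' where "k' = (r / norm k) *\<^sub>R k"
    have k': "norm k' = r" using k r by (simp add: k'_def)
    obtain z where z: "norm z = r" "0 \<le> h \<bullet> z" "0 \<le> z \<bullet> k'"
      using exists_vector_inner_nonneg_both[OF dim, of h k'] k' r_def by metis
    have N1: "(1::real) \<le> 2 ^ N" by simp
    have le2: "2 ^ N * (2 ^ N * r) \<le> norm k"
      using hk by (simp add: M_def r_def mult.assoc)
    moreover have "2 ^ N * r \<le> 2 ^ N * (2 ^ N * r)"
      using mult_right_mono[OF N1, of "2 ^ N * r"] r by simp
    ultimately have le: "2 ^ N * r \<le> norm k" "2 ^ N * (2 ^ N * r) \<le> norm k" by linarith+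
    have 1: "norm (f (x + h) - f x) \<le> (4 / \<delta>) ^ N * norm (f (x + 2 ^ N *\<^sub>R z) - f x)"
      using le \<Omega> z by (intro delta_monotone_on_quarter_turn[OF f \<delta> N, where r = r])
        (auto simp: r_def subset_iff)
    have 2: "norm (f (x + 2 ^ N *\<^sub>R z) - f x) \<le>
        (4 / \<delta>) ^ N * norm (f (x + 2 ^ N *\<^sub>R (2 ^ N *\<^sub>R k')) - f x)"
      using le \<Omega> z k' by (intro delta_monotone_on_quarter_turn[OF f \<delta> N, where r = "2 ^ N * r"])
        (auto simp: subset_iff)
    have eq: "k = (norm k / (M * r)) *\<^sub>R (2 ^ N *\<^sub>R (2 ^ N *\<^sub>R k'))"
      using k r by (simp add: k'_def M_def field_simps)
    have "1 \<le> norm k / (M * r)" using hk M r by (simp add: r_def)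
    moreover have "x \<in> \<Omega>" "x + k \<in> \<Omega>" "x + 2 ^ N *\<^sub>R (2 ^ N *\<^sub>R k') \<in> \<Omega>"
      using \<Omega> le k' r by (auto simp: subset_iff dist_norm)
    ultimately have 3: "norm (f (x + 2 ^ N *\<^sub>R (2 ^ N *\<^sub>R k')) - f x) \<le> 1 / \<delta> * norm (f (x + k) - f x)"
      using delta_monotone_on_ray[OF f \<delta>(1), of x "2 ^ N *\<^sub>R (2 ^ N *\<^sub>R k')" "norm k / (M * r)"]
      by (simp only: flip: eq)
    have "norm (f (x + h) - f x) \<le> (4 / \<delta>) ^ N * ((4 / \<delta>) ^ N * (1 / \<delta> * norm (f (x + k) - f x)))"
      using \<delta> by (intro order_trans[OF 1] order_trans[OF 2] mult_left_mono 3) auto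
    then show ?thesis by (simp add: K_def mult.assoc)
  qed (use K in simp)
  with that M K show ?thesis by blast
qed

section \<open>Continuity\<close>

lemma delta_monotone_on_isCont:
  fixes f :: "'a::euclidean_space \<Rightarrow> 'a"
  assumes dim: "DIM('a) \<ge> 2"
    and f: "delta_monotone_on \<delta> \<Omega> f" and \<delta>: "0 < \<delta>" "\<delta> \<le> 1"
    and "open \<Omega>" "x \<in> \<Omega>"
  shows "isCont f x"
proof -
  obtain M K where M: "M \<ge> 1" and K: "K \<ge> 1"
    and qs: "\<And>x h k. M * norm h \<le> norm k \<Longrightarrow> cball x (norm k) \<subseteq> \<Omega> \<Longrightarrow>
      norm (f (x + h) - f x) \<le> K * norm (f (x + k) - f x)"
    using delta_monotone_on_weakly_quasisymmetric[OF dim f \<delta>] by blast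
  obtain R where R: "R > 0" "cball x R \<subseteq> \<Omega>"
    using assms(5,6) open_contains_cball by blast
  obtain u :: 'a where u: "norm u = 1" using vector_choose_size[of 1] by auto
  define \<phi> where "\<phi> s = f (x + s *\<^sub>R u) \<bullet> u" for s
  have ray: "\<delta> * norm (f (x + t *\<^sub>R u) - f (x + s *\<^sub>R u)) \<le> \<phi> t - \<phi> s"
    if "0 \<le> s" "s < t" "t \<le> R" for s t
  proof -
    have "x + s *\<^sub>R u \<in> \<Omega>" "x + t *\<^sub>R u \<in> \<Omega>"
      using that R u by (auto simp: subset_iff dist_norm)
    from delta_monotone_onD[OF f this(2,1)]
    have "\<delta> * norm ((t - s) *\<^sub>R u) * norm (f (x + t *\<^sub>R u) - f (x + s *\<^sub>R u)) \<le>
        (t - s) * (\<phi> t - \<phi> s)"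
      by (simp add: \<phi>_def inner_diff_left algebra_simps)
    with that u have "(t - s) * (\<delta> * norm (f (x + t *\<^sub>R u) - f (x + s *\<^sub>R u))) \<le>
        (t - s) * (\<phi> t - \<phi> s)"
      by (simp add: ac_simps)
    with that show ?thesis by simp
  qed
  have mono: "\<phi> s \<le> \<phi> t" if "0 \<le> s" "s \<le> t" "t \<le> R" for s t
    using ray[of s t] that \<delta> by (cases "s = t") (smt (verit) mult_nonneg_nonneg norm_ge_zero)+
  show ?thesis
    unfolding continuous_at_eps_delta
  proof (intro allI impI)
    fix e :: real assume e: "e > 0"
    \<comment> \<open>Only positive \<open>s\<close> are used: a jump of \<phi> at 0 is not yet
      excluded. As \<open>l\<close> is the right limit of \<phi> at 0, \<phi> varies little on
      \<open>{0<..r}\<close> for small \<open>r\<close>.\<close>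
    define l where "l = Inf (\<phi> ` {0<..R})"
    have bdd: "bdd_below (\<phi> ` {0<..R})"
      by (rule bdd_belowI[of _ "\<phi> 0"]) (use mono in auto)
    have "l < l + e * \<delta> / (2 * K)" using e \<delta> K by simp
    moreover have "\<phi> ` {0<..R} \<noteq> {}" using R by auto
    ultimately obtain r where r: "0 < r" "r \<le> R" "\<phi> r < l + e * \<delta> / (2 * K)"
      using cInf_lessD[of "\<phi> ` {0<..R}" "l + e * \<delta> / (2 * K)", folded l_def] by auto
    \<comment> \<open>Ensures s + 2Ms < r whenever s = |y - x| < d.\<close>
    define d where "d = r / (1 + 2 * M)"
    have d: "d > 0" using r M by (simp add: d_def)
    have "dist (f y) (f x) < e" if y: "dist y x < d" "y \<noteq> x" for y
    proof -
      define s where "s = dist y x"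
      have s: "0 < s" "s + 2 * M * s < r"
        using y M by (auto simp: s_def d_def field_simps)
      have Ms: "2 * M * s > 0" using s M by simp
      \<comment> \<open>Centring quasisymmetry at \<open>p\<close> instead of \<open>x\<close>
        avoids the possible jump at 0. Both \<open>x\<close> and \<open>y\<close> lie within 2s of
        \<open>p\<close>, hence a comparison vector of length 2Ms.\<close>
      define p where "p = x + s *\<^sub>R u"
      have p: "norm (f (p + (2 * M * s) *\<^sub>R u) - f p) < e / (2 * K)"
      proof -
        have "l \<le> \<phi> s" unfolding l_def
          by (rule cInf_lower[OF _ bdd]) (use s Ms r in auto)
        moreover have "\<phi> (s + 2 * M * s) \<le> \<phi> r"
          using mono[of "s + 2 * M * s" r] s Ms r by auto
        ultimately have "\<delta> * norm (f (x + (s + 2 * M * s) *\<^sub>R u) - f (x + s *\<^sub>R u)) < e * \<delta> / (2 * K)"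
          using ray[of s "s + 2 * M * s"] s Ms r by linarith
        then show ?thesis using \<delta> K by (simp add: p_def algebra_simps field_simps)
      qed
      have close: "norm (f z - f p) < e / 2" if z: "norm (z - p) \<le> 2 * s" for z
      proof -
        have "cball p (norm ((2 * M * s) *\<^sub>R u)) \<subseteq> cball x R"
          using u s Ms r by (auto simp: p_def cball_subset_cball_iff dist_norm)
        then have "norm (f (p + (z - p)) - f p) \<le> K * norm (f (p + (2 * M * s) *\<^sub>R u) - f p)"
          using z M u Ms s R by (intro qs) (auto simp: abs_mult)
        also have "\<dots> < K * (e / (2 * K))" using p K by (intro mult_strict_left_mono) auto
        finally show ?thesis using K by simp
      qed
      have "norm (y - p) \<le> norm (y - x) + norm (x - p)"
        using norm_triangle_ineq[of "y - x" "x - p"] by simp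
      then have "norm (y - p) \<le> 2 * s" "norm (x - p) \<le> 2 * s"
        using u s by (auto simp: p_def s_def dist_norm)
      from close[OF this(1)] close[OF this(2)] show ?thesis
        using norm_triangle_ineq4[of "f y - f p" "f x - f p"] by (simp add: dist_norm)
    qed
    with d show "\<exists>d>0. \<forall>y. dist y x < d \<longrightarrow> dist (f y) (f x) < e"
      using e by (metis dist_self)
  qed
qed

section \<open>Peano's theorem\<close>

text \<open>For negative \<open>t\<close> the integral is over the empty set and vanishes, so the
  bound also covers the negative times at which delayed iterates are evaluated.\<close>

lemma integral_from_0_lipschitz:
  fixes G :: "real \<Rightarrow> 'a::euclidean_space"
  assumes G: "continuous_on UNIV G" and B: "\<And>t. norm (G t) \<le> B"
  shows "norm (integral {0..t} G - integral {0..s} G) \<le> B * \<bar>t - s\<bar>"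
proof -
  have cont: "continuous_on X G" for X using G continuous_on_subset by blast
  have "0 \<le> B" using B[of 0] norm_ge_zero order_trans by blast
  have *: "norm (integral {0..t} G - integral {0..s} G) \<le> B * (t - s)" if "s \<le> t" for s t
  proof (cases "0 \<le> s")
    case True
    have "integral {0..s} G + integral {s..t} G = integral {0..t} G"
      by (rule Henstock_Kurzweil_Integration.integral_combine[OF True that integrable_continuous_real[OF cont]])
    moreover have "norm (integral {s..t} G) \<le> B * (t - s)"
      using that B by (intro integral_bound cont) auto
    ultimately show ?thesis by (metis add_diff_cancel_left')
  next
    case False
    show ?thesis
    proof (cases "0 \<le> t")
      case True
      have "norm (integral {0..t} G) \<le> B * (t - 0)"
        using True B by (intro integral_bound cont) auto
      also have "\<dots> \<le> B * (t - s)" using \<open>0 \<le> B\<close> False by (intro mult_left_mono) auto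
      finally show ?thesis using False by simp
    qed (use False that \<open>0 \<le> B\<close> in auto)
  qed
  show ?thesis
    using *[of s t] *[of t s] by (cases "s \<le> t") (auto simp: norm_minus_commute)
qed

text \<open>Picard iteration for the delayed equation \<open>x'(t) = F (x (t - \<eta>))\<close>: the \<open>k\<close>-th iterate is exact up to
  time \<open>k \<eta>\<close>. For \<open>t < 0\<close> the interval of integration is empty, so the history is constantly \<open>x0\<close>.\<close>

primrec tonelli :: "('a::euclidean_space \<Rightarrow> 'a) \<Rightarrow> 'a \<Rightarrow> real \<Rightarrow> nat \<Rightarrow> real \<Rightarrow> 'a" where
  "tonelli F x0 \<eta> 0 = (\<lambda>t. x0)"
| "tonelli F x0 \<eta> (Suc k) = (\<lambda>t. x0 + integral {0..t} (\<lambda>s. F (tonelli F x0 \<eta> k (s - \<eta>))))"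

text \<open>A Lipschitz iterate makes the next integrand continuous, and the bound on
  \<open>F\<close> makes its primitive Lipschitz again. That \<open>B\<close> depends on neither
  \<open>k\<close> nor \<eta> supplies equicontinuity.\<close>

lemma tonelli_lipschitz:
  assumes F: "continuous_on UNIV F" and B: "\<And>z. norm (F z) \<le> B"
  shows "norm (tonelli F x0 \<eta> k t - tonelli F x0 \<eta> k s) \<le> B * \<bar>t - s\<bar>"
    and "continuous_on UNIV (\<lambda>s. F (tonelli F x0 \<eta> k (s - \<eta>)))"
proof -
  have B0: "0 \<le> B" using B[of 0] norm_ge_zero order_trans by blast
  have cont: "continuous_on UNIV (\<lambda>s. F (X (s - \<eta>)))"
    if "\<And>t s. norm (X t - X s) \<le> B * \<bar>t - s\<bar>" for X :: "real \<Rightarrow> 'a"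
  proof -
    have "B-lipschitz_on UNIV X" using that B0 by (intro lipschitz_onI) (auto simp: dist_norm)
    then have "continuous_on UNIV X" by (rule lipschitz_on_continuous_on)
    then have "continuous_on UNIV (\<lambda>s. X (s - \<eta>))"
      by (rule continuous_on_compose2) (auto intro!: continuous_intros)
    then show ?thesis by (rule continuous_on_compose2[OF F]) auto
  qed
  have lip: "norm (tonelli F x0 \<eta> k t - tonelli F x0 \<eta> k s) \<le> B * \<bar>t - s\<bar>" for t s
  proof (induction k arbitrary: t s)
    case (Suc k)
    then show ?case
      using integral_from_0_lipschitz[OF cont B, of "tonelli F x0 \<eta> k" t s] by simp
  qed (use B0 in simp)
  show "norm (tonelli F x0 \<eta> k t - tonelli F x0 \<eta> k s) \<le> B * \<bar>t - s\<bar>" by (rule lip)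
  show "continuous_on UNIV (\<lambda>s. F (tonelli F x0 \<eta> k (s - \<eta>)))" by (rule cont[OF lip])
qed

text \<open>Up to time (k+1)\<eta> the delayed integrand sees only times at most k\<eta>, where the
  preceding iterates already agree.\<close>

lemma tonelli_stable: "t \<le> real k * \<eta> \<Longrightarrow> tonelli F x0 \<eta> (Suc k) t = tonelli F x0 \<eta> k t"
proof (induction k arbitrary: t)
  case 0
  then show ?case by (cases "t = 0") auto
next
  case (Suc k)
  have "integral {0..t} (\<lambda>s. F (tonelli F x0 \<eta> (Suc k) (s - \<eta>))) =
      integral {0..t} (\<lambda>s. F (tonelli F x0 \<eta> k (s - \<eta>)))"
    using Suc.prems by (intro integral_cong arg_cong[of _ _ F] Suc.IH) (auto simp: algebra_simps)
  then show ?case by simp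
qed

text \<open>Tonelli's scheme: let the delay tend to 0, extract a uniform limit by Arzela-Ascoli, and
  pass to the limit in the integral equation by dominated convergence.\<close>

lemma peano_forward:
  fixes F :: "'a::euclidean_space \<Rightarrow> 'a"
  assumes F: "continuous_on UNIV F" and B: "\<And>z. norm (F z) \<le> B" and T: "0 < T"
  obtains x where "x 0 = x0"
    "\<And>t. t \<in> {0..T} \<Longrightarrow> (x has_vector_derivative F (x t)) (at t within {0..T})"
    "\<And>t. t \<in> {0..T} \<Longrightarrow> norm (x t - x0) \<le> B * t"
proof -
  have B0: "0 \<le> B" using B[of 0] norm_ge_zero order_trans by blast
  \<comment> \<open>With delay T/(n+1), \<open>Suc n\<close> iterations reach exactly time
    \<open>T\<close>, so \<open>X n\<close> solves the delayed equation on all of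
    \<open>{0..T}\<close>.\<close>
  define \<eta> where "\<eta> n = T / real (Suc n)" for n
  define X where "X n = tonelli F x0 (\<eta> n) (Suc n)" for n
  have lip: "norm (X n t - X n s) \<le> B * \<bar>t - s\<bar>" for n t s
    unfolding X_def by (rule tonelli_lipschitz(1)[OF F B])
  have X: "X n t = x0 + integral {0..t} (\<lambda>s. F (X n (s - \<eta> n)))" if "t \<le> T" for n t
    using tonelli_stable[of t "Suc n" "\<eta> n" F x0] that
    unfolding X_def by (simp add: \<eta>_def del: tonelli.simps(2) add: tonelli.simps(2)[of _ _ _ "Suc n"])
  have X0: "X n 0 = x0" for n using X[of 0 n] T by simp
  obtain g \<kappa> where g: "continuous_on {0..T} g" and \<kappa>: "strict_mono (\<kappa> :: nat \<Rightarrow> nat)"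
    and lim: "\<And>e. 0 < e \<Longrightarrow> \<exists>N. \<forall>n x. n \<ge> N \<and> x \<in> {0..T} \<longrightarrow> norm (X (\<kappa> n) x - g x) < e"
  proof (rule Arzela_Ascoli[of "{0..T}" X "norm x0 + B * T"])
    fix n t assume "t \<in> {0..T}"
    then show "norm (X n t) \<le> norm x0 + B * T"
      using lip[of n t 0] X0[of n] norm_triangle_ineq2[of "X n t" x0]
        mult_left_mono[OF _ B0, of t T] by auto
  next
    fix t e :: real assume "0 < e"
    \<comment> \<open>Dividing by \<open>B + 1\<close> guards against B = 0.\<close>
    have "norm (X n t - X n s) < e" if "norm (t - s) < e / (B + 1)" for n s
    proof -
      have "norm (X n t - X n s) \<le> (B + 1) * \<bar>t - s\<bar>"
        using lip[of n t s] by (simp add: algebra_simps)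
      also have "\<dots> < e" using that B0 by (simp add: field_simps)
      finally show ?thesis .
    qed
    moreover have "0 < e / (B + 1)" using \<open>0 < e\<close> B0 by simp
    ultimately show "\<exists>d>0. \<forall>n s. s \<in> {0..T} \<and> norm (t - s) < d \<longrightarrow> norm (X n t - X n s) < e"
      by blast
  qed auto
  have lim': "(\<lambda>n. X (\<kappa> n) t) \<longlonglongrightarrow> g t" if "t \<in> {0..T}" for t
    unfolding LIMSEQ_iff using lim that by blast
  have "\<eta> \<longlonglongrightarrow> 0"
    unfolding \<eta>_def using tendsto_mult_right_zero[OF LIMSEQ_inverse_real_of_nat, of T]
    by (simp add: divide_inverse)
  then have \<eta>0: "(\<lambda>n. \<eta> (\<kappa> n)) \<longlonglongrightarrow> 0"
    using LIMSEQ_subseq_LIMSEQ[OF _ \<kappa>] by (auto simp: o_def)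
  have delayed: "(\<lambda>n. F (X (\<kappa> n) (s - \<eta> (\<kappa> n)))) \<longlonglongrightarrow> F (g s)" if s: "s \<in> {0..T}" for s
  proof -
    have "(\<lambda>n. X (\<kappa> n) (s - \<eta> (\<kappa> n)) - X (\<kappa> n) s) \<longlonglongrightarrow> 0"
    proof (rule Lim_null_comparison)
      show "\<forall>\<^sub>F n in sequentially. norm (X (\<kappa> n) (s - \<eta> (\<kappa> n)) - X (\<kappa> n) s) \<le> B * \<bar>\<eta> (\<kappa> n)\<bar>"
        using lip[of _ "s - \<eta> _" s] by (intro always_eventually allI) simp
      show "(\<lambda>n. B * \<bar>\<eta> (\<kappa> n)\<bar>) \<longlonglongrightarrow> 0"
        using tendsto_mult_right_zero[OF tendsto_rabs_zero[OF \<eta>0]] by simp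
    qed
    from tendsto_add[OF this lim'[OF s]]
    have "(\<lambda>n. X (\<kappa> n) (s - \<eta> (\<kappa> n))) \<longlonglongrightarrow> g s" by simp
    then show ?thesis
      using F by (intro isCont_tendsto_compose[of _ F]) (auto simp: continuous_on_eq_continuous_at)
  qed
  have Fg: "continuous_on {0..T} (\<lambda>s. F (g s))"
    by (rule continuous_on_compose2[OF F g]) auto
  have g_eq: "g t = x0 + integral {0..t} (\<lambda>s. F (g s))" if t: "t \<in> {0..T}" for t
  proof -
    have "(\<lambda>n. integral {0..t} (\<lambda>s. F (X (\<kappa> n) (s - \<eta> (\<kappa> n))))) \<longlonglongrightarrow> integral {0..t} (\<lambda>s. F (g s))"
    proof (rule dominated_convergence(2))
      show "(\<lambda>s. F (X (\<kappa> n) (s - \<eta> (\<kappa> n)))) integrable_on {0..t}" for n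
        unfolding X_def
        by (intro integrable_continuous_real continuous_on_subset[OF tonelli_lipschitz(2)[OF F B]]) auto
      show "(\<lambda>s. B) integrable_on {0..t}" by (rule integrable_const_ivl)
    qed (use B delayed t in auto)
    then have "(\<lambda>n. x0 + integral {0..t} (\<lambda>s. F (X (\<kappa> n) (s - \<eta> (\<kappa> n))))) \<longlonglongrightarrow>
        x0 + integral {0..t} (\<lambda>s. F (g s))"
      by (intro tendsto_intros)
    moreover have "(\<lambda>n. x0 + integral {0..t} (\<lambda>s. F (X (\<kappa> n) (s - \<eta> (\<kappa> n))))) = (\<lambda>n. X (\<kappa> n) t)"
      using X t by auto
    ultimately show ?thesis using lim'[OF t] LIMSEQ_unique by metis
  qed
  show ?thesis
  proof (rule that)
    show "g 0 = x0" using g_eq[of 0] T by simp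
  next
    fix t assume t: "t \<in> {0..T}"
    have D: "((\<lambda>u. x0 + integral {0..u} (\<lambda>s. F (g s))) has_vector_derivative F (g t)) (at t within {0..T})"
      using integral_has_vector_derivative[OF Fg t] by (auto intro!: derivative_eq_intros)
    show "(g has_vector_derivative F (g t)) (at t within {0..T})"
      by (rule has_vector_derivative_transform[OF t _ D]) (rule g_eq)
    have "norm (integral {0..t} (\<lambda>s. F (g s))) \<le> B * (t - 0)"
      using t B by (intro integral_bound continuous_on_subset[OF Fg]) auto
    moreover have "g t - x0 = integral {0..t} (\<lambda>s. F (g s))"
      by (subst g_eq[OF t]) simp
    ultimately show "norm (g t - x0) \<le> B * t" by simp
  qed
qed

text \<open>Negative times come from solving forwards for -F and reversing time; the halves share
  value and derivative at 0, so they glue.\<close>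

lemma peano_two_sided:
  fixes F :: "'a::euclidean_space \<Rightarrow> 'a"
  assumes F: "continuous_on UNIV F" and B: "\<And>z. norm (F z) \<le> B" and T: "0 < T"
  obtains x where "x 0 = x0"
    "\<And>t. t \<in> {-T<..<T} \<Longrightarrow> (x has_vector_derivative F (x t)) (at t)"
    "\<And>t. t \<in> {-T<..<T} \<Longrightarrow> norm (x t - x0) \<le> B * \<bar>t\<bar>"
proof -
  obtain g where g: "g 0 = x0"
    "\<And>t. t \<in> {0..T} \<Longrightarrow> (g has_vector_derivative F (g t)) (at t within {0..T})"
    "\<And>t. t \<in> {0..T} \<Longrightarrow> norm (g t - x0) \<le> B * t"
    using peano_forward[OF F B T, of x0] by blast
  have "continuous_on UNIV (\<lambda>z. - F z)" using F by (intro continuous_intros)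
  moreover have "norm (- F z) \<le> B" for z using B by simp
  ultimately obtain h where h: "h 0 = x0"
    "\<And>t. t \<in> {0..T} \<Longrightarrow> (h has_vector_derivative - F (h t)) (at t within {0..T})"
    "\<And>t. t \<in> {0..T} \<Longrightarrow> norm (h t - x0) \<le> B * t"
    using peano_forward[of "\<lambda>z. - F z" B T x0] T by blast
  define x where "x t = (if t \<in> {0..T} then g t else h (- t))" for t
  have h': "((\<lambda>t. h (- t)) has_vector_derivative F (h (- t))) (at t within {-T..0})"
    if "t \<in> {-T..0}" for t
  proof -
    have "(uminus has_vector_derivative (- 1 :: real)) (at t within {-T..0})"
      by (auto intro!: derivative_eq_intros)
    moreover have "(h has_vector_derivative - F (h (- t))) (at (- t) within uminus ` {-T..0})"
      using h(2)[of "- t"] that by simp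
    ultimately show ?thesis
      using vector_diff_chain_within[of uminus "- 1" t "{-T..0}" h "- F (h (- t))"] by (simp add: o_def)
  qed
  show ?thesis
  proof (rule that)
    show "x 0 = x0" using T g(1) by (simp add: x_def)
    fix t assume t: "t \<in> {-T<..<T}"
    have cl: "{0..T} \<inter> {-T..0} = {0}" using T by auto
    have "(x has_vector_derivative (if t \<in> {0..T} then F (g t) else F (h (- t)))) (at t within {-T..T})"
      unfolding x_def
    proof (rule has_vector_derivative_If_within_closures)
      show "t \<in> {0..T} \<union> {-T..0}" "{-T..T} = {0..T} \<union> {-T..0}" using t T by auto
    next
      assume "t \<in> {0..T} \<union> (closure {0..T} \<inter> closure {-T..0})"
      then have "t \<in> {0..T}" using T by (auto simp: cl)
      moreover have "{0..T} \<union> (closure {0..T} \<inter> closure {-T..0}) = {0..T}" using T by (auto simp: cl)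
      ultimately show "(g has_vector_derivative F (g t)) (at t within {0..T} \<union> (closure {0..T} \<inter> closure {-T..0}))"
        using g(2) by simp
    next
      assume "t \<in> {-T..0} \<union> (closure {0..T} \<inter> closure {-T..0})"
      then have "t \<in> {-T..0}" using T by (auto simp: cl)
      moreover have "{-T..0} \<union> (closure {0..T} \<inter> closure {-T..0}) = {-T..0}" using T by (auto simp: cl)
      ultimately show "((\<lambda>t. h (- t)) has_vector_derivative F (h (- t)))
          (at t within {-T..0} \<union> (closure {0..T} \<inter> closure {-T..0}))"
        using h' by simp
    next
      assume "t \<in> closure {0..T}" "t \<in> closure {-T..0}"
      then have "t = 0" by auto
      then show "g t = h (- t)" "F (g t) = F (h (- t))" using g(1) h(1) by auto
    qed
    moreover have "(if t \<in> {0..T} then F (g t) else F (h (- t))) = F (x t)" by (simp add: x_def)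
    ultimately show "(x has_vector_derivative F (x t)) (at t)"
      using t by (simp add: at_within_Icc_at)
    show "norm (x t - x0) \<le> B * \<bar>t\<bar>"
      using g(3)[of t] h(3)[of "- t"] t by (auto simp: x_def)
  qed
qed

section \<open>Existence for a continuous field on an open set\<close>

text \<open>Composing \<open>f\<close> with the nearest-point projection onto a closed ball in
  \<Omega> gives a bounded continuous field on the whole space. Its solutions stay in the ball for
  |t| < R/B, where the field is \<open>f\<close>.\<close>

lemma continuous_imp_autonomous_ivp_solution:
  fixes f :: "'a::euclidean_space \<Rightarrow> 'a"
  assumes "open \<Omega>" "continuous_on \<Omega> f" "x0 \<in> \<Omega>"
  obtains I x where "autonomous_ivp_solution f \<Omega> x0 I x"
proof -
  obtain R where R: "R > 0" "cball x0 R \<subseteq> \<Omega>"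
    using assms open_contains_cball by blast
  have f: "continuous_on (cball x0 R) f" using assms(2) R(2) continuous_on_subset by blast
  then have "bounded (f ` cball x0 R)"
    by (intro compact_imp_bounded compact_continuous_image) auto
  then obtain B where B: "B > 0" "\<And>z. z \<in> cball x0 R \<Longrightarrow> norm (f z) \<le> B"
    unfolding bounded_pos by auto
  define F where "F z = f (closest_point (cball x0 R) z)" for z
  have cp: "closest_point (cball x0 R) z \<in> cball x0 R" for z
    using R(1) by (intro closest_point_in_set) auto
  have "continuous_on UNIV F"
    unfolding F_def
    by (rule continuous_on_compose2[OF f])
      (use R(1) cp in \<open>auto intro!: continuous_on_closest_point simp del: mem_cball\<close>)
  moreover have "norm (F z) \<le> B" for z unfolding F_def using B(2) cp by blast
  moreover have T: "R / B > 0" using R(1) B(1) by simp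
  ultimately obtain x where x: "x 0 = x0"
    "\<And>t. t \<in> {-(R / B)<..<R / B} \<Longrightarrow> (x has_vector_derivative F (x t)) (at t)"
    "\<And>t. t \<in> {-(R / B)<..<R / B} \<Longrightarrow> norm (x t - x0) \<le> B * \<bar>t\<bar>"
    using peano_two_sided[of F B "R / B" x0] by blast
  have "x t \<in> cball x0 R" if "t \<in> {-(R / B)<..<R / B}" for t
  proof -
    have "B * \<bar>t\<bar> \<le> B * (R / B)" using that B(1) by (intro mult_left_mono) auto
    then show ?thesis using x(3)[OF that] B(1) by (simp add: dist_norm norm_minus_commute)
  qed
  moreover from this have "F (x t) = f (x t)" if "t \<in> {-(R / B)<..<R / B}" for t
    using that by (simp add: F_def closest_point_self del: mem_cball)
  ultimately have "autonomous_ivp_solution f \<Omega> x0 {-(R / B)<..<R / B} x"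
    unfolding autonomous_ivp_solution_def autonomous_solution_def
    using x T R(2) by (auto simp: is_interval_oo)
  then show ?thesis by (rule that)
qed

section \<open>Uniqueness\<close>

lemma has_real_derivative_norm:
  fixes z :: "real \<Rightarrow> 'a::real_inner"
  assumes "(z has_vector_derivative z') (at t)" "z t \<noteq> 0"
  shows "((\<lambda>t. norm (z t)) has_real_derivative (z t \<bullet> z') / norm (z t)) (at t)"
proof -
  have "((\<lambda>t. norm (z t)) has_derivative (\<lambda>h. (h *\<^sub>R z') \<bullet> sgn (z t))) (at t)"
    by (rule has_derivative_compose[OF assms(1)[unfolded has_vector_derivative_def]
          has_derivative_norm[OF assms(2)]])
  then show ?thesis
    unfolding has_field_derivative_def
    by (rule has_derivative_eq_rhs) (auto simp: sgn_div_norm inner_commute field_simps)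
qed

text \<open>The derivative of |x-y|^2 is 2(f(x)-f(y)).(x-y), nonnegative by monotonicity.
  Coincidence at \<open>b\<close> thus forces coincidence at \<open>a\<close>.\<close>

lemma delta_monotone_on_solutions_expand:
  assumes f: "delta_monotone_on \<delta> \<Omega> f" "0 < \<delta>" and "a \<le> b"
    and x: "\<And>t. t \<in> {a..b} \<Longrightarrow> (x has_vector_derivative f (x t)) (at t) \<and> x t \<in> \<Omega>"
    and y: "\<And>t. t \<in> {a..b} \<Longrightarrow> (y has_vector_derivative f (y t)) (at t) \<and> y t \<in> \<Omega>"
  shows "norm (x a - y a) \<le> norm (x b - y b)"
proof -
  have "(x a - y a) \<bullet> (x a - y a) \<le> (x b - y b) \<bullet> (x b - y b)"
  proof (rule DERIV_nonneg_imp_nondecreasing[OF \<open>a \<le> b\<close>], intro exI conjI)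
    fix t assume "a \<le> t" "t \<le> b"
    then have t: "t \<in> {a..b}" by simp
    have z: "((\<lambda>t. x t - y t) has_vector_derivative f (x t) - f (y t)) (at t)"
      using x[OF t] y[OF t] by (intro derivative_intros) auto
    show "((\<lambda>t. (x t - y t) \<bullet> (x t - y t)) has_real_derivative
        2 * ((f (x t) - f (y t)) \<bullet> (x t - y t))) (at t)"
      unfolding has_field_derivative_def
      by (rule has_derivative_eq_rhs[OF has_derivative_inner[OF z[unfolded has_vector_derivative_def]
              z[unfolded has_vector_derivative_def]]])
        (auto simp: inner_commute)
    show "0 \<le> 2 * ((f (x t) - f (y t)) \<bullet> (x t - y t))"
      using delta_monotone_on_imp_inner_nonneg[OF f(1)] f(2) x[OF t] y[OF t] by simp
  qed
  then show ?thesis by (simp add: norm_le)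
qed

section \<open>Uniqueness forwards in time\<close>

lemma delta_monotone_on_forward_unique:
  fixes f :: "'a::euclidean_space \<Rightarrow> 'a"
  assumes dim: "DIM('a) \<ge> 2"
    and f: "delta_monotone_on \<delta> \<Omega> f" and \<delta>: "0 < \<delta>" "\<delta> \<le> 1"
    and \<Omega>: "open \<Omega>" and T0: "0 < T0"
    and x: "\<And>t. t \<in> {0..T0} \<Longrightarrow> (x has_vector_derivative f (x t)) (at t) \<and> x t \<in> \<Omega>"
    and y: "\<And>t. t \<in> {0..T0} \<Longrightarrow> (y has_vector_derivative f (y t)) (at t) \<and> y t \<in> \<Omega>"
    and xy: "x 0 = y 0" and f0: "f (x 0) \<noteq> 0"
  obtains T where "T > 0" "\<And>t. t \<in> {0..T} \<Longrightarrow> x t = y t"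
proof -
  obtain M K where M: "M \<ge> 1" and K: "K \<ge> 1"
    and qs: "\<And>x h k. M * norm h \<le> norm k \<Longrightarrow> cball x (norm k) \<subseteq> \<Omega> \<Longrightarrow>
      norm (f (x + h) - f x) \<le> K * norm (f (x + k) - f x)"
    using delta_monotone_on_weakly_quasisymmetric[OF dim f \<delta>] by blast
  define v where "v = f (x 0)"
  have v: "norm v > 0" using f0 by (simp add: v_def)
  \<comment> \<open>\<epsilon> will bound |f(x(t)) - v|. Its value gives A|v|\<epsilon>L = 1/4, for
    the final contradiction, and \<epsilon> \<le> \<delta>|v|/4, for the estimate of \<phi>.\<close>
  define \<epsilon> where "\<epsilon> = \<delta> * norm v / (16 * K * M)"
  \<comment> \<open>\<open>A\<close> is \<open>K\<close> divided by the constant \<delta>|v|/2 of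
    the estimate for \<phi>; \<open>L\<close> makes \<open>x\<close> travel at least M\<omega> in
    time L\<omega>, as quasisymmetry requires.\<close>
  define A L where "A = 2 * K / (\<delta> * norm v)" and "L = 2 * M / norm v"
  have A: "A > 0" and L: "L > 0" using v \<delta> K M by (auto simp: A_def L_def)
  have \<epsilon>: "\<epsilon> > 0" using v \<delta> K M by (simp add: \<epsilon>_def)
  have "\<epsilon> \<le> \<delta> * norm v / (16 * 1)"
    unfolding \<epsilon>_def using mult_ge1_I[OF K M] \<delta> v by (intro divide_left_mono) auto
  then have \<epsilon>_le: "\<epsilon> \<le> \<delta> * norm v / 4" using mult_pos_pos[OF \<delta>(1) v] by linarith
  moreover have "\<delta> * norm v \<le> norm v" using \<delta> v by (simp add: mult_le_cancel_right2)
  ultimately have \<epsilon>_le': "\<epsilon> \<le> norm v / 4" by linarith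
  have AL: "A * norm v * \<epsilon> * L = 1 / 4"
    using v \<delta> K M by (simp add: A_def L_def \<epsilon>_def field_simps)

  have x_cont: "isCont x t" and y_cont: "isCont y t" if "t \<in> {0..T0}" for t
    using x[OF that] y[OF that] has_vector_derivative_continuous by blast+
  obtain R where R: "R > 0" "cball (x 0) R \<subseteq> \<Omega>"
    using x[of 0] T0 \<Omega> open_contains_cball[of \<Omega>] by auto
  have "isCont f (x 0)" using x[of 0] T0 by (intro delta_monotone_on_isCont[OF dim f \<delta> \<Omega>]) auto
  then have "isCont (\<lambda>t. f (x t)) 0" using isCont_o2[OF x_cont[of 0]] T0 by simp
  then obtain d1 where d1: "d1 > 0" "\<And>t. dist t 0 < d1 \<Longrightarrow> dist (f (x t)) v < \<epsilon>"
    using \<epsilon> unfolding continuous_at_eps_delta v_def by blast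
  \<comment> \<open>With R/3, chords of \<open>x\<close> have length at most 2R/3, so balls of that
    radius about x(t) stay in the ball of radius \<open>R\<close>.\<close>
  obtain d2 where d2: "d2 > 0" "\<And>t. dist t 0 < d2 \<Longrightarrow> dist (x t) (x 0) < R / 3"
    using x_cont[of 0, unfolded continuous_at_eps_delta, rule_format, of "R / 3"] T0 R by auto
  define T1 where "T1 = min T0 (min (d1 / 2) (d2 / 2))"
  have T1: "0 < T1" "T1 \<le> T0" "T1 < d1" "T1 < d2" using T0 d1(1) d2(1) by (auto simp: T1_def)
  have near: "norm (f (x t) - v) \<le> \<epsilon>" "norm (x t - x 0) \<le> R / 3" if "t \<in> {0..T1}" for t
    using d1(2)[of t] d2(2)[of t] that T1 by (auto simp: dist_norm)

  define \<omega> where "\<omega> t = norm (x t - y t)" for t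
  have "isCont \<omega> 0" unfolding \<omega>_def using x_cont[of 0] y_cont[of 0] T0 by (intro continuous_intros) auto
  moreover have \<omega>0: "\<omega> 0 = 0" using xy by (simp add: \<omega>_def)
  moreover have "T1 / (2 * L) > 0" using T1 L by simp
  ultimately obtain d3 where d3: "d3 > 0" "\<And>t. dist t 0 < d3 \<Longrightarrow> dist (\<omega> t) 0 < T1 / (2 * L)"
    unfolding continuous_at_eps_delta by metis
  \<comment> \<open>One half of \<open>T1\<close> is reserved for \<open>t\<close>, the other for
    L\<omega>(t), so that s(t) \<le> T1.\<close>
  define T where "T = min (T1 / 2) (d3 / 2)"
  have T: "0 < T" "T \<le> T1 / 2" "T < d3" using T1 d3(1) by (auto simp: T_def)
  define s where "s t = t + L * \<omega> t" for t
  have s: "t \<le> s t" "s t \<le> T1" if "t \<in> {0..T}" for t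
  proof -
    have "\<omega> t < T1 / (2 * L)" using d3(2)[of t] that T by auto
    then have "L * \<omega> t \<le> T1 / 2" using L by (simp add: field_simps)
    then show "t \<le> s t" "s t \<le> T1" using that T L by (auto simp: s_def \<omega>_def)
  qed
  have mono: "\<omega> a \<le> \<omega> b" if "0 \<le> a" "a \<le> b" "b \<le> T" for a b
    unfolding \<omega>_def using that T T1 x y
    by (intro delta_monotone_on_solutions_expand[OF f \<delta>(1)]) auto

  have lin: "norm (x b - x a - (b - a) *\<^sub>R v) \<le> (b - a) * \<epsilon>" if "0 \<le> a" "a \<le> b" "b \<le> T1" for a b
  proof -
    have "norm (x b - x a - (b - a) *\<^sub>R f (x 0)) \<le> norm (b - a) * \<epsilon>"
      by (rule vector_differentiable_bound_linearization[where S = "{0..T1}"])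
        (use x T1 near that in \<open>auto simp: closed_segment_eq_real_ivl v_def
          intro: has_vector_derivative_at_within\<close>)
    then show ?thesis using that by (simp add: v_def)
  qed
  define \<phi> where "\<phi> t = f (x t) \<bullet> v" for t
  \<comment> \<open>Apply \<delta>-monotonicity along \<open>x\<close>, whose displacement is hv up
    to h\<epsilon>. Using hv in the norm and in the inner product costs at most a quarter of
    \<delta>h|v||D| each, leaving the factor 1/2.\<close>
  have \<phi>: "\<delta> * norm v / 2 * norm (f (x b) - f (x a)) \<le> \<phi> b - \<phi> a"
    if ab: "0 \<le> a" "a \<le> b" "b \<le> T1" for a b
  proof (cases "a = b")
    case False
    define D where "D = f (x b) - f (x a)"
    define k where "k = x b - x a"
    define h where "h = b - a"
    have h: "h > 0" using ab False by (simp add: h_def)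
    have k: "norm (k - h *\<^sub>R v) \<le> h * \<epsilon>" using lin[OF ab] by (simp add: k_def h_def)
    have 1: "\<delta> * norm k * norm D \<le> h * (D \<bullet> v) + D \<bullet> (k - h *\<^sub>R v)"
      using delta_monotone_onD[OF f, of "x b" "x a"] x[of a] x[of b] ab T1
      by (simp add: D_def k_def inner_diff_right)
    have 2: "D \<bullet> (k - h *\<^sub>R v) \<le> norm D * (h * \<epsilon>)"
      using k by (meson mult_left_mono norm_cauchy_schwarz norm_ge_zero order_trans)
    have "h * norm v - h * \<epsilon> \<le> norm k"
      using norm_triangle_ineq3[of k "h *\<^sub>R v"] k h by simp
    then have "(\<delta> * norm D) * (h * norm v - h * \<epsilon>) \<le> (\<delta> * norm D) * norm k"
      using \<delta> by (intro mult_left_mono) simp_all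
    then have 3: "\<delta> * (norm D * (h * norm v)) - \<delta> * (norm D * (h * \<epsilon>)) \<le> \<delta> * norm k * norm D"
      by (simp only: right_diff_distrib ac_simps)
    have 4: "\<delta> * (norm D * (h * \<epsilon>)) \<le> norm D * (h * \<epsilon>)"
      using h \<epsilon> \<delta> by (simp add: mult_left_le_one_le)
    have "norm D * (h * \<epsilon>) \<le> norm D * (h * (\<delta> * norm v / 4))"
      using \<epsilon>_le h by (intro mult_left_mono) simp_all
    then have 5: "norm D * (h * \<epsilon>) \<le> \<delta> * (norm D * (h * norm v)) / 4" by (simp add: ac_simps)
    have "p / 2 \<le> z" if "e \<le> z + i" "i \<le> q" "p - q' \<le> e" "q' \<le> q" "q \<le> p / 4" for e z i p q q' :: real
      using that by linarith
    from this[OF 1 2 3 4 5] have "h * (\<delta> * norm v / 2 * norm D) \<le> h * (D \<bullet> v)"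
      by (simp add: ac_simps)
    with h show ?thesis by (simp add: D_def \<phi>_def inner_diff_left)
  qed simp

  have speed: "norm (f (x t) - f (y t)) \<le> A * (\<phi> (s t) - \<phi> t)" if t: "t \<in> {0..T}" for t
  proof -
    define k where "k = x (s t) - x t"
    have t1: "0 \<le> t" "t \<le> s t" "s t \<le> T1" "t \<in> {0..T1}" "s t \<in> {0..T1}" using s[OF t] t T by auto
    have h: "L * \<omega> t = s t - t" "L * \<omega> t \<ge> 0" using L by (auto simp: s_def \<omega>_def)
    \<comment> \<open>As \<epsilon> \<le> |v|/4, the chord has length at least (3/4)L\<omega>|v| =
      (3/2)M\<omega>.\<close>
    have "L * \<omega> t * norm v - L * \<omega> t * \<epsilon> \<le> norm k"
      using norm_triangle_ineq3[of k "(L * \<omega> t) *\<^sub>R v"] lin[OF t1(1-3)] h by (simp add: k_def)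
    moreover have "L * \<omega> t * \<epsilon> \<le> L * \<omega> t * (norm v / 4)"
      using \<epsilon>_le' h by (intro mult_left_mono) auto
    moreover have "L * \<omega> t * norm v = 2 * M * \<omega> t" using v by (simp add: L_def)
    moreover have "M * \<omega> t \<ge> 0" using M by (simp add: \<omega>_def)
    ultimately have "M * \<omega> t \<le> norm k" by simp
    then have "M * norm (y t - x t) \<le> norm k" by (simp add: \<omega>_def norm_minus_commute)
    moreover have "cball (x t) (norm k) \<subseteq> cball (x 0) R"
    proof -
      have "norm k \<le> 2 * R / 3"
        using norm_triangle_ineq4[of "x (s t) - x 0" "x t - x 0"] near(2)[OF t1(4)] near(2)[OF t1(5)]
        by (simp add: k_def)
      then show ?thesis using near(2)[OF t1(4)] by (auto simp: cball_subset_cball_iff dist_norm)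
    qed
    ultimately have "norm (f (x t + (y t - x t)) - f (x t)) \<le> K * norm (f (x t + k) - f (x t))"
      using R by (intro qs) auto
    then have "norm (f (x t) - f (y t)) \<le> K * norm (f (x (s t)) - f (x t))"
      by (simp add: k_def norm_minus_commute)
    also have "\<dots> = A * (\<delta> * norm v / 2 * norm (f (x (s t)) - f (x t)))"
      using v \<delta> by (simp add: A_def)
    also have "\<dots> \<le> A * (\<phi> (s t) - \<phi> t)"
      using \<phi>[OF t1(1-3)] A by (intro mult_left_mono) auto
    finally show ?thesis .
  qed

  have "\<omega> T = 0"
  proof (rule ccontr)
    assume "\<omega> T \<noteq> 0"
    then have W: "\<omega> T > 0" by (simp add: \<omega>_def)
    \<comment> \<open>With |A P| \<le> \<omega>/4 at both ends, monotonicity of A P - \<omega> would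
      give -(5/16)\<omega>(T) \<le> -(3/4)\<omega>(T).\<close>
    have "\<exists>t\<ge>0. t \<le> T \<and> \<omega> t = \<omega> T / 4"
    proof (rule IVT)
      show "\<forall>t. 0 \<le> t \<and> t \<le> T \<longrightarrow> isCont \<omega> t"
        unfolding \<omega>_def using x_cont y_cont T T1 by (auto intro!: continuous_intros)
    qed (use W T \<omega>0 in auto)
    then obtain t1 where t1: "0 \<le> t1" "t1 \<le> T" "\<omega> t1 = \<omega> T / 4" by blast
    \<comment> \<open>\<open>P t\<close> is the integral of \<open>\<phi> - \<phi> 0\<close> over \<open>[t, s t]\<close>. Starting at \<open>t1\<close> instead of \<open>0\<close> keeps \<open>\<omega>\<close>
      positive, hence differentiable.\<close>
    define P where "P t = (x (s t) \<bullet> v - s t * (v \<bullet> v)) - (x t \<bullet> v - t * (v \<bullet> v))" for t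
    have P: "\<bar>A * P t\<bar> \<le> \<omega> t / 4" if t: "t \<in> {0..T}" for t
    proof -
      have "P t = (x (s t) - x t - (s t - t) *\<^sub>R v) \<bullet> v"
        by (simp add: P_def inner_diff_left algebra_simps)
      also have "\<bar>\<dots>\<bar> \<le> norm (x (s t) - x t - (s t - t) *\<^sub>R v) * norm v"
        by (rule Cauchy_Schwarz_ineq2)
      also have "\<dots> \<le> (s t - t) * \<epsilon> * norm v"
        using lin[of t "s t"] s[OF t] t by (intro mult_right_mono) auto
      finally have "\<bar>A * P t\<bar> \<le> A * ((s t - t) * \<epsilon> * norm v)"
        using A by (simp add: abs_mult)
      also have "\<dots> = (A * norm v * \<epsilon> * L) * \<omega> t" by (simp add: s_def)
      finally show ?thesis by (simp add: AL)
    qed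
    \<comment> \<open>The derivative is A(\<phi>(s) - \<phi>(t)) - \<omega>', nonnegative by
      \<open>speed\<close>, plus AL\<omega>'(\<phi>(s) - \<phi>(0)), nonnegative since \<omega> and
      \<phi> are nondecreasing.\<close>
    have "A * P t1 - \<omega> t1 \<le> A * P T - \<omega> T"
    proof (rule DERIV_nonneg_imp_nondecreasing[OF t1(2)], intro exI conjI)
      fix t assume "t1 \<le> t" "t \<le> T"
      then have t: "t \<in> {0..T}" "t \<in> {0..T0}" using t1 T T1 by auto
      have st: "0 \<le> s t" "s t \<le> T1" "s t \<in> {0..T0}" using s[OF t(1)] t(1) T1 by auto
      have "\<omega> t > 0" using mono[of t1 t] t1 W \<open>t1 \<le> t\<close> \<open>t \<le> T\<close> by simp
      then have xy: "x t - y t \<noteq> 0" by (auto simp: \<omega>_def)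
      define \<omega>' where "\<omega>' = ((x t - y t) \<bullet> (f (x t) - f (y t))) / norm (x t - y t)"
      have D\<omega>: "(\<omega> has_real_derivative \<omega>') (at t)"
        unfolding \<omega>_def \<omega>'_def using x[OF t(2)] y[OF t(2)] xy
        by (intro has_real_derivative_norm derivative_intros) auto
      have Ds: "(s has_real_derivative 1 + L * \<omega>') (at t)"
        unfolding s_def by (auto intro!: derivative_eq_intros D\<omega>)
      have Dinner: "((\<lambda>t. z t \<bullet> v) has_real_derivative z' \<bullet> v) (at t)"
        if "(z has_vector_derivative z') (at t)" for z z'
        using has_derivative_inner_left[OF that[unfolded has_vector_derivative_def], of v]
        unfolding has_field_derivative_def by (rule has_derivative_eq_rhs) auto
      have Dxs: "((\<lambda>t. x (s t)) has_vector_derivative (1 + L * \<omega>') *\<^sub>R f (x (s t))) (at t)"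
        using vector_diff_chain_at[of s "1 + L * \<omega>'" t x] x[OF st(3)] Ds
        by (simp add: o_def has_real_derivative_iff_has_vector_derivative)
      show "((\<lambda>t. A * P t - \<omega> t) has_real_derivative
          A * ((1 + L * \<omega>') * (\<phi> (s t) - v \<bullet> v) - (\<phi> t - v \<bullet> v)) - \<omega>') (at t)"
        unfolding P_def
        by (rule derivative_eq_intros refl Dinner[OF Dxs] Dinner Ds D\<omega> | use x[OF t(2)] in blast)+
          (simp add: \<phi>_def algebra_simps)
      have "0 \<le> \<omega>'"
        using delta_monotone_on_imp_inner_nonneg[OF f] \<delta> x[OF t(2)] y[OF t(2)]
        by (simp add: \<omega>'_def inner_commute)
      have "(x t - y t) \<bullet> (f (x t) - f (y t)) \<le> norm (x t - y t) * norm (f (x t) - f (y t))"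
        by (rule norm_cauchy_schwarz)
      then have "\<omega>' \<le> norm (f (x t) - f (y t))"
        using xy by (simp add: \<omega>'_def field_simps)
      also note speed[OF t(1)]
      finally have "\<omega>' \<le> A * (\<phi> (s t) - \<phi> t)" .
      moreover have "0 \<le> \<phi> (s t) - v \<bullet> v"
      proof -
        have "0 \<le> \<delta> * norm v / 2 * norm (f (x (s t)) - f (x 0))" using \<delta> by simp
        also have "\<dots> \<le> \<phi> (s t) - \<phi> 0" using \<phi>[of 0 "s t"] st by simp
        finally show ?thesis by (simp add: \<phi>_def v_def)
      qed
      then have "0 \<le> A * (L * \<omega>' * (\<phi> (s t) - v \<bullet> v))"
        using A L \<open>0 \<le> \<omega>'\<close> by (intro mult_nonneg_nonneg) auto
      ultimately show "0 \<le> A * ((1 + L * \<omega>') * (\<phi> (s t) - v \<bullet> v) - (\<phi> t - v \<bullet> v)) - \<omega>'"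
        by (simp add: algebra_simps)
    qed
    with P[of t1] P[of T] t1 T W show False by auto
  qed
  have "x t = y t" if "t \<in> {0..T}" for t
    using mono[of t T] that \<open>\<omega> T = 0\<close> by (simp add: \<omega>_def)
  with that T show ?thesis by blast
qed

theorem theorem1p4:
  fixes f :: "real ^ 'n \<Rightarrow> real ^ 'n" and \<Omega> :: "(real ^ 'n) set"
    and \<delta> :: real and x0 :: "real ^ 'n"
  assumes "CARD('n) \<ge> 2"
    and "open \<Omega>" and "connected \<Omega>"
    and "0 < \<delta>" and "\<delta> \<le> 1"
    and "\<not> f constant_on \<Omega>"
    and "delta_monotone_on \<delta> \<Omega> f"
    and "x0 \<in> \<Omega>" and "f x0 \<noteq> 0"
  shows "(\<exists>I x. autonomous_ivp_solution f \<Omega> x0 I x) \<and>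
    (\<forall>I x J y. autonomous_ivp_solution f \<Omega> x0 I x \<longrightarrow> autonomous_ivp_solution f \<Omega> x0 J y \<longrightarrow>
       (\<exists>U. open U \<and> 0 \<in> U \<and> U \<subseteq> I \<inter> J \<and> (\<forall>t\<in>U. x t = y t)))"
proof (intro conjI allI impI)
  have dim: "DIM(real ^ 'n) \<ge> 2" using assms(1) by simp
  note f = assms(7) and \<delta> = assms(4,5)
  have "continuous_on \<Omega> f"
    using delta_monotone_on_isCont[OF dim f \<delta> assms(2)] by (intro continuous_at_imp_continuous_on) blast
  from continuous_imp_autonomous_ivp_solution[OF assms(2) this assms(8)]
  show "\<exists>I x. autonomous_ivp_solution f \<Omega> x0 I x" by metis
  fix I x J y
  assume "autonomous_ivp_solution f \<Omega> x0 I x" "autonomous_ivp_solution f \<Omega> x0 J y"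
  then have IJ: "open (I \<inter> J)" "0 \<in> I \<inter> J" and xy0: "x 0 = x0" "y 0 = x0"
    and x: "\<And>t. t \<in> I \<Longrightarrow> (x has_vector_derivative f (x t)) (at t) \<and> x t \<in> \<Omega>"
    and y: "\<And>t. t \<in> J \<Longrightarrow> (y has_vector_derivative f (y t)) (at t) \<and> y t \<in> \<Omega>"
    unfolding autonomous_ivp_solution_def autonomous_solution_def by auto
  from IJ obtain r where r: "r > 0" "cball 0 r \<subseteq> I \<inter> J" using open_contains_cball by blast
  have sub: "t \<in> I" "t \<in> J" if "\<bar>t\<bar> \<le> r" for t using r(2) that by (auto simp: subset_iff)
  obtain T where T: "T > 0" "\<And>t. t \<in> {0..T} \<Longrightarrow> x t = y t"
    by (rule delta_monotone_on_forward_unique[OF dim f \<delta> assms(2) r(1), of x y])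
      (use x y sub xy0 assms(9) in auto)
  have "x t = y t" if "\<bar>t\<bar> < min r T" for t
  proof (cases "0 \<le> t")
    \<comment> \<open>At negative times the distance of the solutions is at most their distance at
      0.\<close>
    case False
    then have "norm (x t - y t) \<le> norm (x 0 - y 0)"
      using that x y sub by (intro delta_monotone_on_solutions_expand[OF f \<delta>(1)]) auto
    then show ?thesis using xy0 by simp
  qed (use that T(2) in auto)
  then show "\<exists>U. open U \<and> 0 \<in> U \<and> U \<subseteq> I \<inter> J \<and> (\<forall>t\<in>U. x t = y t)"
    using r(1) T(1) sub by (intro exI[of _ "ball 0 (min r T)"]) auto
qed

end
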